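(* Let $X,Y$ be topological spaces, $A:X\to Y$ continuous, and let $k_X,k_Y$ be continuous, bounded, strictly positive definite kernels on $X$ and $Y$ with native spaces $\mathcal N(X)$ and $\mathcal N(Y)$. Let $\mathcal X=\{x_1,\dots,x_N\}\subset X$ and $\mathcal Y=\{y_1,\dots,y_M\}\subset Y$ be sets of pairwise distinct centers. Then $\widehat{\mathcal K}_A=\widetilde S_{\mathcal X}\mathcal K_A$ (as operators on $\mathcal N(Y)$). If moreover $\mathcal K_A\,\mathcal N(Y)\subset\mathcal N(X)$, then $\widehat{\mathcal K}_A^{\mathcal Y}=S_{\mathcal X}\mathcal K_A$ if and only if $A(\mathcal X)\subset\mathcal Y$.
   Context: All functions are real-valued. $C_b(X)$ is the space of bounded continuous functions with the sup-norm. A symmetric kernel $k$ is strictly positive definite if $(k(x_i,x_j))_{i,j=1}^n$ is positive definite for every finite set of pairwise distinct points. The native space $\mathcal N(X)\subset C_b(X)$ is the reproducing kernel Hilbert space of $k_X$, with canonical features $\Phi_x=k_X(x,\cdot)$; similarly $\Psi_y=k_Y(y,\cdot)$ for $\mathcal N(Y)$. The Koopman operator $\mathcal K_A:C_b(Y)\to C_b(X)$ is $\mathcal K_Af=f\circ A$. For a finite set $\mathcal X=\{x_1,\dots,x_N\}\subset X$ of pairwise distinct points, $V_{\mathcal X}=\operatorname{span}\{\Phi_{x_i}:1\le i\le N\}$, and $S_{\mathcal X}:\mathcal N(X)\to V_{\mathcal X}$ is the orthogonal projection in $\mathcal N(X)$; equivalently $S_{\mathcal X}f$ is the unique element of $V_{\mathcal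 X}$ agreeing with $f$ on $\mathcal X$. Its extension $\widetilde S_{\mathcal X}:C_b(X)\to V_{\mathcal X}$ maps $f\in C_b(X)$ to the unique element of $V_{\mathcal X}$ agreeing with $f$ on $\mathcal X$. For a finite $\mathcal Y\subset Y$, $V_{\mathcal Y}$ and $S_{\mathcal Y}:\mathcal N(Y)\to V_{\mathcal Y}$ are defined in the same way using $k_Y$. The approximants are $\widehat{\mathcal K}_A^{\mathcal Y}:=\widetilde S_{\mathcal X}\mathcal K_AS_{\mathcal Y}$ and $\widehat{\mathcal K}_A:=\widehat{\mathcal K}_A^{A(\mathcal X)}=\widetilde S_{\mathcal X}\mathcal K_AS_{A(\mathcal X)}$, as operators on $\mathcal N(Y)$, where $A(\mathcal X)=\{A(x_1),\dots,A(x_N)\}$. *)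

theory Defs
  imports "HOL-Analysis.Analysis"
begin

definition symmetric_kernel :: "('a \<Rightarrow> 'a \<Rightarrow> real) \<Rightarrow> bool" where
  "symmetric_kernel k \<longleftrightarrow> (\<forall>x y. k x y = k y x)"

definition strictly_pos_def_kernel :: "('a \<Rightarrow> 'a \<Rightarrow> real) \<Rightarrow> bool" where
  "strictly_pos_def_kernel k \<longleftrightarrow>
     symmetric_kernel k \<and>
     (\<forall>F c. finite F \<longrightarrow> (\<exists>x\<in>F. c x \<noteq> 0) \<longrightarrow> (\<Sum>x\<in>F. \<Sum>y\<in>F. c x * k x y * c y) > 0)"

definition continuous_kernel :: "('a::topological_space \<Rightarrow> 'a \<Rightarrow> real) \<Rightarrow> bool" where
  "continuous_kernel k \<longleftrightarrow> continuous_on UNIV (\<lambda>(x, y). k x y)"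

definition bounded_kernel :: "('a \<Rightarrow> 'a \<Rightarrow> real) \<Rightarrow> bool" where
  "bounded_kernel k \<longleftrightarrow> bounded (range (\<lambda>(x, y). k x y))"

text \<open>The type \<open>'a \<Rightarrow>\<^sub>C real\<close> is the space of bounded continuous functions with the sup-norm.
  \<open>Bcontfun\<close> is unspecified outside the bounded continuous functions; the two evaluation lemmas
  below show that it is applied sensibly.\<close>

definition feature :: "('a::topological_space \<Rightarrow> 'a \<Rightarrow> real) \<Rightarrow> 'a \<Rightarrow> ('a \<Rightarrow>\<^sub>C real)" where
  "feature k x = Bcontfun (\<lambda>y. k x y)"

lemma apply_feature:
  assumes "continuous_kernel k" and "bounded_kernel k"
  shows "apply_bcontfun (feature k x) y = k x y"
proof -
  have "continuous_on UNIV ((\<lambda>(x, y). k x y) \<circ> Pair x)"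
    using assms(1) unfolding continuous_kernel_def
    by (intro continuous_on_compose continuous_intros) (auto intro: continuous_on_subset)
  moreover have "bounded (range (k x))"
    using assms(2) unfolding bounded_kernel_def by (rule bounded_subset) auto
  ultimately have "k x \<in> bcontfun"
    by (auto simp: bcontfun_def o_def)
  then show ?thesis
    by (simp add: feature_def Bcontfun_inverse)
qed

definition koopman ::
  "('a::topological_space \<Rightarrow> 'b::topological_space) \<Rightarrow> ('b \<Rightarrow>\<^sub>C real) \<Rightarrow> ('a \<Rightarrow>\<^sub>C real)" where
  "koopman A f = Bcontfun (apply_bcontfun f \<circ> A)"

lemma apply_koopman:
  assumes "continuous_on UNIV A"
  shows "apply_bcontfun (koopman A f) x = apply_bcontfun f (A x)"
proof -
  have "continuous_on UNIV (apply_bcontfun f \<circ> A)"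
    using assms by (intro continuous_on_compose continuous_intros) auto
  moreover have "bounded (range (apply_bcontfun f \<circ> A))"
    by (rule bounded_subset[OF bounded_apply_bcontfun[of f]]) auto
  ultimately have "apply_bcontfun f \<circ> A \<in> bcontfun"
    by (auto simp: bcontfun_def)
  then show ?thesis
    by (simp add: koopman_def Bcontfun_inverse)
qed

text \<open>\<open>native_space k H ip\<close>: the set \<open>H\<close> of bounded continuous functions with the inner
  product \<open>ip\<close> is the reproducing kernel Hilbert space of \<open>k\<close>. By the Moore--Aronszajn theorem
  every symmetric positive definite kernel has exactly one reproducing kernel Hilbert space, and for
  a bounded continuous kernel all of its members are bounded and continuous; so \<open>H\<close> and the values
  of \<open>ip\<close> on \<open>H\<close> are determined by \<open>k\<close>. The values of \<open>ip\<close> off \<open>H\<close> are irrelevant.\<close>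

locale native_space =
  fixes k :: "'a::topological_space \<Rightarrow> 'a \<Rightarrow> real"
    and H :: "('a \<Rightarrow>\<^sub>C real) set"
    and ip :: "('a \<Rightarrow>\<^sub>C real) \<Rightarrow> ('a \<Rightarrow>\<^sub>C real) \<Rightarrow> real"
  assumes subspace_H: "subspace H"
    and ip_commute: "\<lbrakk>f \<in> H; g \<in> H\<rbrakk> \<Longrightarrow> ip f g = ip g f"
    and ip_add_left: "\<lbrakk>f \<in> H; g \<in> H; h \<in> H\<rbrakk> \<Longrightarrow> ip (f + g) h = ip f h + ip g h"
    and ip_scaleR_left: "\<lbrakk>f \<in> H; g \<in> H\<rbrakk> \<Longrightarrow> ip (c *\<^sub>R f) g = c * ip f g"
    and ip_pos: "\<lbrakk>f \<in> H; f \<noteq> 0\<rbrakk> \<Longrightarrow> ip f f > 0"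
    and complete_H:
      "\<lbrakk>\<And>n. s n \<in> H;
        \<And>e. e > 0 \<Longrightarrow> \<exists>n0. \<forall>m\<ge>n0. \<forall>n\<ge>n0. sqrt (ip (s m - s n) (s m - s n)) < e\<rbrakk>
       \<Longrightarrow> \<exists>l\<in>H. (\<lambda>n. sqrt (ip (s n - l) (s n - l))) \<longlonglongrightarrow> 0"
    and feature_in_H: "feature k x \<in> H"
    and reproducing: "f \<in> H \<Longrightarrow> ip f (feature k x) = apply_bcontfun f x"

definition kernel_span :: "('a::topological_space \<Rightarrow> 'a \<Rightarrow> real) \<Rightarrow> 'a set \<Rightarrow> ('a \<Rightarrow>\<^sub>C real) set" where
  "kernel_span k F = span (feature k ` F)"

definition kernel_proj ::
  "('a::topological_space \<Rightarrow> 'a \<Rightarrow> real) \<Rightarrow> (('a \<Rightarrow>\<^sub>C real) \<Rightarrow> ('a \<Rightarrow>\<^sub>C real) \<Rightarrow> real) \<Rightarrow> 'a set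
    \<Rightarrow> ('a \<Rightarrow>\<^sub>C real) \<Rightarrow> ('a \<Rightarrow>\<^sub>C real)" where
  "kernel_proj k ip F f =
     (THE s. s \<in> kernel_span k F \<and> (\<forall>v \<in> kernel_span k F. ip (f - s) v = 0))"

definition kernel_interp ::
  "('a::topological_space \<Rightarrow> 'a \<Rightarrow> real) \<Rightarrow> 'a set \<Rightarrow> ('a \<Rightarrow>\<^sub>C real) \<Rightarrow> ('a \<Rightarrow>\<^sub>C real)" where
  "kernel_interp k F f =
     (THE s. s \<in> kernel_span k F \<and> (\<forall>x \<in> F. apply_bcontfun s x = apply_bcontfun f x))"

definition koopman_approx ::
  "('a::topological_space \<Rightarrow> 'a \<Rightarrow> real) \<Rightarrow> 'a set
    \<Rightarrow> ('b::topological_space \<Rightarrow> 'b \<Rightarrow> real) \<Rightarrow> (('b \<Rightarrow>\<^sub>C real) \<Rightarrow> ('b \<Rightarrow>\<^sub>C real) \<Rightarrow> real) \<Rightarrow> 'b set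
    \<Rightarrow> ('a \<Rightarrow> 'b) \<Rightarrow> ('b \<Rightarrow>\<^sub>C real) \<Rightarrow> ('a \<Rightarrow>\<^sub>C real)" where
  "koopman_approx kX XX kY ipY YY A f =
     kernel_interp kX XX (koopman A (kernel_proj kY ipY YY f))"

end

theory Submission
  imports Defs
begin

text \<open>
  The statement says that all operators in sight depend only on values at finitely many points.
  Strict positive definiteness makes interpolation from the span of the features at a finite set
  \<open>F\<close> uniquely solvable (\<open>interpolant_exists\<close>, \<open>kernel_span_zero\<close>), so two functions have the
  same interpolant exactly when they agree on \<open>F\<close> (\<open>kernel_interp_eq_iff\<close>). By the reproducing
  property, orthogonality of \<open>f - s\<close> to the features at \<open>F\<close> means that \<open>f - s\<close> vanishes on \<open>F\<close>;
  hence the orthogonal projection of a function of the native space is its interpolant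
  (\<open>kernel_proj_eq_interp\<close>).

  Both claims, the first with \<open>YY = A ` XX\<close>, therefore compare \<open>f\<close> with its interpolant \<open>s\<close> at \<open>YY\<close>,
  after composition with \<open>A\<close> and at the points of \<open>XX\<close> only, that is, on \<open>A ` XX\<close>. If \<open>A ` XX \<subseteq> YY\<close>, then \<open>f\<close> and \<open>s\<close> agree
  there. If some point \<open>A x\<close> with \<open>x \<in> XX\<close> lies outside \<open>YY\<close>, the native space contains a function
  that vanishes on \<open>YY\<close> but not at \<open>A x\<close>; its interpolant is \<open>0\<close>, which does not agree with it on
  \<open>A ` XX\<close> (\<open>kernel_interp_agrees_iff\<close>).
\<close>

section \<open>Spans of features\<close>

lemma apply_bcontfun_sum:
  "apply_bcontfun (\<Sum>i\<in>F. f i) y = (\<Sum>i\<in>F. apply_bcontfun (f i) y)"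
  by (induction F rule: infinite_finite_induct) (auto simp: plus_bcontfun.rep_eq)

lemma feature_in_kernel_span: "x \<in> F \<Longrightarrow> feature k x \<in> kernel_span k F"
  by (simp add: kernel_span_def span_base)

lemma kernel_span_mono: "F \<subseteq> G \<Longrightarrow> kernel_span k F \<subseteq> kernel_span k G"
  unfolding kernel_span_def by (intro span_mono image_mono)

lemma subspace_kernel_span: "subspace (kernel_span k F)"
  by (simp add: kernel_span_def)

text \<open>Coefficients indexed by \<open>F\<close> rather than by the set of features can be fed into the quadratic
  form of the kernel without first showing that distinct points have distinct features.\<close>

lemma kernel_span_coefficients:
  assumes "finite F" and "u \<in> kernel_span k F"
  obtains c where "u = (\<Sum>x\<in>F. c x *\<^sub>R feature k x)"
proof -
  have "u \<in> span (feature k ` F)"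
    using assms(2) by (simp add: kernel_span_def)
  then have "\<exists>c. u = (\<Sum>x\<in>F. c x *\<^sub>R feature k x)"
  proof (induction rule: span_induct_alt)
    case base
    have "0 = (\<Sum>x\<in>F. 0 *\<^sub>R feature k x)" by simp
    then show ?case by (rule exI[of _ "\<lambda>_. 0"])
  next
    case (step a v w)
    then obtain c z where c: "w = (\<Sum>x\<in>F. c x *\<^sub>R feature k x)" and z: "z \<in> F" "v = feature k z"
      by auto
    have "(\<Sum>x\<in>F. (if x = z then a else 0) *\<^sub>R feature k x)
        = (\<Sum>x\<in>F. if x = z then a *\<^sub>R feature k x else 0)"
      by (rule sum.cong) auto
    also have "\<dots> = a *\<^sub>R v"
      using z assms(1) by simp
    finally have "a *\<^sub>R v + w = (\<Sum>x\<in>F. ((if x = z then a else 0) + c x) *\<^sub>R feature k x)"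
      by (simp add: c scaleR_left_distrib sum.distrib)
    then show ?case by (rule exI[of _ "\<lambda>x. (if x = z then a else 0) + c x"])
  qed
  then show ?thesis using that by blast
qed

section \<open>Interpolation with a strictly positive definite kernel\<close>

locale interpolation_kernel =
  fixes k :: "'a::topological_space \<Rightarrow> 'a \<Rightarrow> real"
  assumes continuous: "continuous_kernel k"
    and bounded: "bounded_kernel k"
    and strictly_pos_def: "strictly_pos_def_kernel k"
begin

lemma apply_kernel_combination:
  "apply_bcontfun (\<Sum>x\<in>F. c x *\<^sub>R feature k x) y = (\<Sum>x\<in>F. c x * k x y)"
  by (simp add: apply_bcontfun_sum scaleR_bcontfun.rep_eq apply_feature continuous bounded)

text \<open>Summing \<open>u\<close> over \<open>F\<close> with its own coefficients as weights gives the quadratic form of the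
  kernel matrix, so a nontrivial combination cannot vanish at all points of \<open>F\<close>.\<close>

lemma kernel_combination_pos:
  assumes "finite F" and "x \<in> F" and "c x \<noteq> 0" and u: "u = (\<Sum>x\<in>F. c x *\<^sub>R feature k x)"
  shows "(\<Sum>y\<in>F. c y * apply_bcontfun u y) > 0"
proof -
  have "(\<Sum>x\<in>F. \<Sum>y\<in>F. c x * k x y * c y) > 0"
    using assms(1-3) strictly_pos_def unfolding strictly_pos_def_kernel_def by blast
  also have "(\<Sum>x\<in>F. \<Sum>y\<in>F. c x * k x y * c y) = (\<Sum>y\<in>F. \<Sum>x\<in>F. c x * k x y * c y)"
    by (rule sum.swap)
  also have "\<dots> = (\<Sum>y\<in>F. c y * apply_bcontfun u y)"
    unfolding u apply_kernel_combination by (simp add: sum_distrib_left mult_ac)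
  finally show ?thesis .
qed

lemma kernel_span_zero:
  assumes "finite F" and "u \<in> kernel_span k F" and "\<And>x. x \<in> F \<Longrightarrow> apply_bcontfun u x = 0"
  shows "u = 0"
proof -
  obtain c where u: "u = (\<Sum>x\<in>F. c x *\<^sub>R feature k x)"
    using assms(1,2) by (rule kernel_span_coefficients)
  have "c x = 0" if "x \<in> F" for x
  proof (rule ccontr)
    assume "c x \<noteq> 0"
    then have "(\<Sum>y\<in>F. c y * apply_bcontfun u y) > 0"
      using assms(1) that u by (intro kernel_combination_pos)
    then show False by (simp add: assms(3))
  qed
  then show ?thesis by (simp add: u)
qed

text \<open>Newton interpolation: enlarge the node set one point \<open>z\<close> at a time, correcting at \<open>z\<close> with the
  residual of \<open>feature k z\<close>, which vanishes at the earlier nodes. It does not vanish at \<open>z\<close>, since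
  otherwise \<open>feature k z\<close> would be a combination of the earlier features.\<close>

lemma interpolant_exists:
  assumes "finite F"
  shows "\<exists>s\<in>kernel_span k F. \<forall>x\<in>F. apply_bcontfun s x = g x"
  using assms
proof (induction F arbitrary: g rule: finite_induct)
  case empty
  then show ?case by (auto simp: kernel_span_def)
next
  case (insert z F)
  obtain s where s: "s \<in> kernel_span k F" "\<And>x. x \<in> F \<Longrightarrow> apply_bcontfun s x = g x"
    using insert.IH by blast
  obtain p where p: "p \<in> kernel_span k F"
      "\<And>x. x \<in> F \<Longrightarrow> apply_bcontfun p x = apply_bcontfun (feature k z) x"
    using insert.IH by blast
  define r where "r = feature k z - p"
  have r_F: "apply_bcontfun r x = 0" if "x \<in> F" for x
    using p(2)[OF that] by (simp add: r_def minus_bcontfun.rep_eq)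
  have "apply_bcontfun r z > 0"
  proof -
    obtain c where c: "p = (\<Sum>x\<in>F. c x *\<^sub>R feature k x)"
      using insert.hyps(1) p(1) by (rule kernel_span_coefficients)
    define d where "d = (\<lambda>x. if x = z then 1 else - c x)"
    have d_F: "(\<Sum>x\<in>F. d x *\<^sub>R feature k x) = (\<Sum>x\<in>F. - (c x *\<^sub>R feature k x))"
      using insert.hyps(2) by (intro sum.cong) (auto simp: d_def)
    have "r = (\<Sum>x\<in>insert z F. d x *\<^sub>R feature k x)"
      using insert.hyps by (simp add: r_def c d_F sum_negf) (simp add: d_def)
    then have "(\<Sum>y\<in>insert z F. d y * apply_bcontfun r y) > 0"
      using insert.hyps(1) by (intro kernel_combination_pos[of _ z]) (auto simp: d_def)
    \<comment> \<open>the residual vanishes on \<open>F\<close>, so of the quadratic form only the term at \<open>z\<close> is left\<close>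
    then show ?thesis
      using insert.hyps by (simp add: r_F) (simp add: d_def)
  qed
  then have r_z: "apply_bcontfun r z \<noteq> 0" by simp
  define t where "t = s + ((g z - apply_bcontfun s z) / apply_bcontfun r z) *\<^sub>R r"
  have sub: "kernel_span k F \<subseteq> kernel_span k (insert z F)"
    by (rule kernel_span_mono) auto
  have "r \<in> kernel_span k (insert z F)"
    using p(1) sub feature_in_kernel_span[of z "insert z F" k]
    unfolding r_def by (auto intro: subspace_diff[OF subspace_kernel_span])
  then have "t \<in> kernel_span k (insert z F)"
    using s(1) sub unfolding t_def
    by (auto intro!: subspace_add[OF subspace_kernel_span] subspace_scale[OF subspace_kernel_span])
  moreover have "\<forall>x\<in>insert z F. apply_bcontfun t x = g x"
    using r_z by (auto simp: t_def plus_bcontfun.rep_eq scaleR_bcontfun.rep_eq r_F s(2))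
  ultimately show ?case by blast
qed

lemma kernel_interp_spec:
  assumes "finite F"
  shows "kernel_interp k F f \<in> kernel_span k F \<and>
    (\<forall>x\<in>F. apply_bcontfun (kernel_interp k F f) x = apply_bcontfun f x)"
  unfolding kernel_interp_def
proof (rule theI')
  show "\<exists>!s. s \<in> kernel_span k F \<and> (\<forall>x\<in>F. apply_bcontfun s x = apply_bcontfun f x)"
  proof (rule ex_ex1I)
    show "\<exists>s. s \<in> kernel_span k F \<and> (\<forall>x\<in>F. apply_bcontfun s x = apply_bcontfun f x)"
      using interpolant_exists[OF assms, of "apply_bcontfun f"] by blast
  next
    fix s t
    assume s: "s \<in> kernel_span k F \<and> (\<forall>x\<in>F. apply_bcontfun s x = apply_bcontfun f x)"
      and t: "t \<in> kernel_span k F \<and> (\<forall>x\<in>F. apply_bcontfun t x = apply_bcontfun f x)"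
    have "s - t = 0"
      using s t
      by (intro kernel_span_zero[OF assms])
        (auto simp: minus_bcontfun.rep_eq intro: subspace_diff[OF subspace_kernel_span])
    then show "s = t" by simp
  qed
qed

lemma kernel_interp_in_span: "finite F \<Longrightarrow> kernel_interp k F f \<in> kernel_span k F"
  using kernel_interp_spec by blast

lemma apply_kernel_interp:
  "finite F \<Longrightarrow> x \<in> F \<Longrightarrow> apply_bcontfun (kernel_interp k F f) x = apply_bcontfun f x"
  using kernel_interp_spec by blast

lemma kernel_interp_eq_iff:
  assumes "finite F"
  shows "kernel_interp k F f = kernel_interp k F g
    \<longleftrightarrow> (\<forall>x\<in>F. apply_bcontfun f x = apply_bcontfun g x)"
proof
  assume "kernel_interp k F f = kernel_interp k F g"
  then show "\<forall>x\<in>F. apply_bcontfun f x = apply_bcontfun g x"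
    using apply_kernel_interp[OF assms] by metis
next
  assume "\<forall>x\<in>F. apply_bcontfun f x = apply_bcontfun g x"
  then show "kernel_interp k F f = kernel_interp k F g"
    unfolding kernel_interp_def by (intro arg_cong[where f = The] ext) auto
qed

text \<open>Interpolation at \<open>F\<close> reproduces the values of every function in \<open>H\<close> at no points other than
  those of \<open>F\<close>: for \<open>y \<notin> F\<close> the function that is \<open>0\<close> on \<open>F\<close> and \<open>1\<close> at \<open>y\<close> has the interpolant \<open>0\<close>.\<close>

lemma kernel_interp_agrees_iff:
  assumes "finite F" and "finite G" and "\<And>E. kernel_span k E \<subseteq> H"
  shows "(\<forall>f\<in>H. \<forall>y\<in>G. apply_bcontfun (kernel_interp k F f) y = apply_bcontfun f y) \<longleftrightarrow> G \<subseteq> F"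
proof
  assume agree: "\<forall>f\<in>H. \<forall>y\<in>G. apply_bcontfun (kernel_interp k F f) y = apply_bcontfun f y"
  show "G \<subseteq> F"
  proof (rule subsetI, rule ccontr)
    fix y assume y: "y \<in> G" "y \<notin> F"
    obtain f where f: "f \<in> kernel_span k (insert y F)"
        "\<And>x. x \<in> insert y F \<Longrightarrow> apply_bcontfun f x = (if x = y then 1 else 0)"
      using interpolant_exists[OF finite.insertI[OF assms(1)], of y "\<lambda>x. if x = y then 1 else 0"]
      by blast
    have "apply_bcontfun f x = 0" if "x \<in> F" for x
      using f(2)[of x] that y(2) by auto
    then have "kernel_interp k F f = 0"
      using assms(1)
      by (intro kernel_span_zero[of F]) (auto simp: kernel_interp_in_span apply_kernel_interp)
    moreover have "apply_bcontfun (kernel_interp k F f) y = apply_bcontfun f y"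
      using agree f(1) assms(3) y(1) by blast
    ultimately show False
      using f(2)[of y] by (simp add: zero_bcontfun.rep_eq)
  qed
qed (auto simp: apply_kernel_interp assms(1))

end

section \<open>Projection in the native space\<close>

context native_space
begin

lemma kernel_span_subset: "kernel_span k F \<subseteq> H"
  unfolding kernel_span_def
  by (rule span_minimal) (auto simp: feature_in_H subspace_H)

text \<open>By linearity, orthogonality to a span need only be tested on the features, and there the
  reproducing property turns it into vanishing at the nodes.\<close>

lemma orthogonal_kernel_span_iff:
  assumes "g \<in> H"
  shows "(\<forall>v\<in>kernel_span k F. ip g v = 0) \<longleftrightarrow> (\<forall>x\<in>F. apply_bcontfun g x = 0)"
proof
  assume "\<forall>v\<in>kernel_span k F. ip g v = 0"
  then show "\<forall>x\<in>F. apply_bcontfun g x = 0"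
    using reproducing[OF assms] feature_in_kernel_span[of _ F k] by fastforce
next
  assume zero: "\<forall>x\<in>F. apply_bcontfun g x = 0"
  have "kernel_span k F \<subseteq> {v \<in> H. ip v g = 0}"
    unfolding kernel_span_def
  proof (rule span_minimal)
    show "feature k ` F \<subseteq> {v \<in> H. ip v g = 0}"
      using zero assms reproducing ip_commute feature_in_H by auto
    have "ip 0 g = 0"
      using ip_scaleR_left[of 0 g 0] subspace_0[OF subspace_H] assms by simp
    then show "subspace {v \<in> H. ip v g = 0}"
      using subspace_H assms
      by (intro subspaceI)
        (auto simp: ip_add_left ip_scaleR_left subspace_0 subspace_add subspace_scale)
  qed
  then show "\<forall>v\<in>kernel_span k F. ip g v = 0"
    using assms ip_commute by auto
qed

text \<open>The projection and the interpolant are picked out of the span by orthogonality and by agreement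
  at the nodes. These are equivalent conditions, so the two descriptions are the same.\<close>

lemma kernel_proj_eq_interp:
  assumes "f \<in> H"
  shows "kernel_proj k ip F f = kernel_interp k F f"
proof -
  have "(\<forall>v\<in>kernel_span k F. ip (f - s) v = 0) \<longleftrightarrow>
      (\<forall>x\<in>F. apply_bcontfun s x = apply_bcontfun f x)" if "s \<in> kernel_span k F" for s
  proof -
    have "f - s \<in> H"
      using assms kernel_span_subset that subspace_diff[OF subspace_H] by blast
    then show ?thesis
      using orthogonal_kernel_span_iff[of "f - s" F] by (auto simp: minus_bcontfun.rep_eq)
  qed
  then show ?thesis
    unfolding kernel_proj_def kernel_interp_def by (intro arg_cong[where f = The] ext) auto
qed

end

section \<open>Koopman approximants\<close>

theorem proposition3p3:
  fixes A :: "'a::topological_space \<Rightarrow> 'b::topological_space"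
    and kX :: "'a \<Rightarrow> 'a \<Rightarrow> real" and kY :: "'b \<Rightarrow> 'b \<Rightarrow> real"
    and NX :: "('a \<Rightarrow>\<^sub>C real) set" and NY :: "('b \<Rightarrow>\<^sub>C real) set"
    and ipX :: "('a \<Rightarrow>\<^sub>C real) \<Rightarrow> ('a \<Rightarrow>\<^sub>C real) \<Rightarrow> real"
    and ipY :: "('b \<Rightarrow>\<^sub>C real) \<Rightarrow> ('b \<Rightarrow>\<^sub>C real) \<Rightarrow> real"
    and XX :: "'a set" and YY :: "'b set"
  assumes "continuous_on UNIV A"
    and "continuous_kernel kX" and "bounded_kernel kX" and "strictly_pos_def_kernel kX"
    and "continuous_kernel kY" and "bounded_kernel kY" and "strictly_pos_def_kernel kY"
    and "native_space kX NX ipX" and "native_space kY NY ipY"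
    and "finite XX" and "finite YY"
  shows "(\<forall>f\<in>NY. koopman_approx kX XX kY ipY (A ` XX) A f = kernel_interp kX XX (koopman A f)) \<and>
    (koopman A ` NY \<subseteq> NX \<longrightarrow>
      ((\<forall>f\<in>NY. koopman_approx kX XX kY ipY YY A f = kernel_proj kX ipX XX (koopman A f))
        \<longleftrightarrow> A ` XX \<subseteq> YY))"
proof -
  interpret X: interpolation_kernel kX by unfold_locales (fact assms)+
  interpret Y: interpolation_kernel kY by unfold_locales (fact assms)+
  interpret NX: native_space kX NX ipX by fact
  interpret NY: native_space kY NY ipY by fact
  have approx_eq_iff: "koopman_approx kX XX kY ipY E A f = kernel_interp kX XX (koopman A f) \<longleftrightarrow>
      (\<forall>y\<in>A ` XX. apply_bcontfun (kernel_interp kY E f) y = apply_bcontfun f y)"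
    if "f \<in> NY" for E f
    unfolding koopman_approx_def NY.kernel_proj_eq_interp[OF that]
      X.kernel_interp_eq_iff[OF \<open>finite XX\<close>]
    by (simp add: apply_koopman \<open>continuous_on UNIV A\<close>)
  have all_approx_eq_iff:
    "(\<forall>f\<in>NY. koopman_approx kX XX kY ipY E A f = kernel_interp kX XX (koopman A f)) \<longleftrightarrow>
      A ` XX \<subseteq> E" if "finite E" for E
    using Y.kernel_interp_agrees_iff[OF that finite_imageI[OF \<open>finite XX\<close>] NY.kernel_span_subset]
    by (simp add: approx_eq_iff)
  show ?thesis
  proof (intro conjI impI)
    show "\<forall>f\<in>NY. koopman_approx kX XX kY ipY (A ` XX) A f = kernel_interp kX XX (koopman A f)"
      using all_approx_eq_iff \<open>finite XX\<close> by blast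
  next
    assume "koopman A ` NY \<subseteq> NX"
    then have "kernel_proj kX ipX XX (koopman A f) = kernel_interp kX XX (koopman A f)"
      if "f \<in> NY" for f
      using that by (intro NX.kernel_proj_eq_interp) auto
    then show "(\<forall>f\<in>NY. koopman_approx kX XX kY ipY YY A f = kernel_proj kX ipX XX (koopman A f))
        \<longleftrightarrow> A ` XX \<subseteq> YY"
      using all_approx_eq_iff[OF \<open>finite YY\<close>] by simp
  qed
qed

end
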